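(* Let $X=\ell_1$ (complex sequences indexed by $\mathbb Z_+$), with canonical basis $(e_j)_{j\ge0}$ and coordinate functionals $(e_j^* )_{j\ge 0}$, and let $$\mathcal T_1(X)=\bigl\{T\in\mathcal B_1(X):\ Te_j\in[e_0,\dots,e_{j+1}]\ \text{and}\ \langle e_{j+1}^*,Te_j\rangle>0\ \text{for every } j\ge0\bigr\}.$$ A typical $T\in(\mathcal T_1(X),\mathrm{SOT})$ has the following properties: the adjoint $T^*$ is a non-surjective isometry of $X^*$; $T-\lambda$ is surjective for every $\lambda\in\mathbb D$; every $\lambda\in\mathbb D$ is an eigenvalue of $T$ with infinite multiplicity, i.e. $\dim\ker(T-\lambda)=\infty$. In particular, a typical $T\in(\mathcal T_1(X),\mathrm{SOT})$ has a non-trivial invariant subspace.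
   Context: $\mathcal B_1(X)$ is the set of all bounded linear operators $T$ on $X$ with $\|T\|\le 1$; $[\,\cdot\,]$ denotes (closed) linear span. SOT (Strong Operator Topology) is the topology of pointwise norm convergence on $X$; $\mathcal T_1(X)$ is a $G_\delta$ subset of the Polish space $(\mathcal B_1(X),\mathrm{SOT})$, hence $(\mathcal T_1(X),\mathrm{SOT})$ is a Polish space. "A typical $T\in(\mathcal T_1(X),\mathrm{SOT})$ satisfies (P)" means that the set of $T\in\mathcal T_1(X)$ satisfying (P) is comeager in $(\mathcal T_1(X),\mathrm{SOT})$. $\mathbb D$ is the open unit disk. "Isometry" means linear norm-preserving map, not necessarily onto. A non-trivial invariant subspace of $T$ is a closed linear subspace $E\subseteq X$ with $E\ne\{0\}$, $E\neq X$ and $T(E)\subseteq E$. *)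

theory Defs
  imports "HOL-Analysis.Analysis"
begin

typedef ell1 = "{x :: nat \<Rightarrow> complex. summable (\<lambda>n. norm (x n))}"
  morphisms coord Abs_ell1
  by (rule exI[of _ "\<lambda>_. 0"]) simp

setup_lifting type_definition_ell1

lemma summable_coord: "summable (\<lambda>n. norm (coord x n))"
  using coord by simp

lemma ell1_eqI: "(\<And>n. coord x n = coord y n) \<Longrightarrow> x = y"
  by (simp add: coord_inject[symmetric] fun_eq_iff)

lemma summable_norm_add:
  fixes x y :: "nat \<Rightarrow> complex"
  assumes "summable (\<lambda>n. norm (x n))" "summable (\<lambda>n. norm (y n))"
  shows "summable (\<lambda>n. norm (x n + y n))"
  by (rule summable_comparison_test'[OF summable_add[OF assms], of 0])
     (simp add: norm_triangle_ineq)

instantiation ell1 :: real_normed_vector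
begin

lift_definition zero_ell1 :: ell1 is "\<lambda>_. 0" by simp

lift_definition plus_ell1 :: "ell1 \<Rightarrow> ell1 \<Rightarrow> ell1" is "\<lambda>x y n. x n + y n"
  by (rule summable_norm_add)

lift_definition uminus_ell1 :: "ell1 \<Rightarrow> ell1" is "\<lambda>x n. - x n" by simp

lift_definition minus_ell1 :: "ell1 \<Rightarrow> ell1 \<Rightarrow> ell1" is "\<lambda>x y n. x n - y n"
proof -
  fix x y :: "nat \<Rightarrow> complex"
  assume "summable (\<lambda>n. norm (x n))" "summable (\<lambda>n. norm (y n))"
  then show "summable (\<lambda>n. norm (x n - y n))"
    using summable_norm_add[of x "\<lambda>n. - y n"] by simp
qed

lift_definition scaleR_ell1 :: "real \<Rightarrow> ell1 \<Rightarrow> ell1" is "\<lambda>r x n. r *\<^sub>R x n"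
  by (simp add: summable_mult)

definition norm_ell1 :: "ell1 \<Rightarrow> real"
  where "norm_ell1 x = (\<Sum>n. norm (coord x n))"

definition sgn_ell1 :: "ell1 \<Rightarrow> ell1"
  where "sgn_ell1 x = inverse (norm x) *\<^sub>R x"

definition dist_ell1 :: "ell1 \<Rightarrow> ell1 \<Rightarrow> real"
  where "dist_ell1 x y = norm (x - y)"

definition uniformity_ell1 :: "(ell1 \<times> ell1) filter"
  where "uniformity_ell1 = (INF e\<in>{0<..}. principal {(x, y). dist x y < e})"

definition open_ell1 :: "ell1 set \<Rightarrow> bool"
  where "open_ell1 U = (\<forall>x\<in>U. \<forall>\<^sub>F (x', y) in uniformity. x' = x \<longrightarrow> y \<in> U)"

instance
proof
  fix x y z :: ell1 and a b :: real and U :: "ell1 set"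
  show "x + y + z = x + (y + z)" by transfer (simp add: add.assoc)
  show "x + y = y + x" by transfer (simp add: add.commute)
  show "0 + x = x" by transfer simp
  show "- x + x = 0" by transfer simp
  show "x - y = x + - y" by transfer simp
  show "a *\<^sub>R (x + y) = a *\<^sub>R x + a *\<^sub>R y" by transfer (simp add: scaleR_add_right)
  show "(a + b) *\<^sub>R x = a *\<^sub>R x + b *\<^sub>R x" by transfer (simp add: scaleR_add_left)
  show "a *\<^sub>R b *\<^sub>R x = (a * b) *\<^sub>R x" by transfer simp
  show "1 *\<^sub>R x = x" by transfer simp
  show "sgn x = inverse (norm x) *\<^sub>R x" by (rule sgn_ell1_def)
  show "dist x y = norm (x - y)" by (rule dist_ell1_def)
  show "uniformity = (INF e\<in>{0<..}. principal {(x, y :: ell1). dist x y < e})"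
    by (rule uniformity_ell1_def)
  show "open U = (\<forall>x\<in>U. \<forall>\<^sub>F (x', y) in uniformity. x' = x \<longrightarrow> y \<in> U)"
    by (rule open_ell1_def)
  have "norm x = 0 \<longleftrightarrow> (\<forall>n. coord x n = 0)"
    unfolding norm_ell1_def using suminf_eq_zero_iff[OF summable_coord[of x]] by simp
  also have "\<dots> \<longleftrightarrow> x = 0" by (auto intro: ell1_eqI simp: zero_ell1.rep_eq)
  finally show "norm x = 0 \<longleftrightarrow> x = 0" .
  have "norm (x + y) \<le> (\<Sum>n. norm (coord x n) + norm (coord y n))"
    unfolding norm_ell1_def
    by (intro suminf_le summable_add summable_coord) (simp add: plus_ell1.rep_eq norm_triangle_ineq)
  also have "\<dots> = norm x + norm y"
    unfolding norm_ell1_def by (rule suminf_add[symmetric]) (rule summable_coord)+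
  finally show "norm (x + y) \<le> norm x + norm y" .
  show "norm (a *\<^sub>R x) = \<bar>a\<bar> * norm x"
    unfolding norm_ell1_def by (simp add: scaleR_ell1.rep_eq suminf_mult summable_coord)
qed

end

lift_definition scaleC_ell1 :: "complex \<Rightarrow> ell1 \<Rightarrow> ell1"  (infixr \<open>*\<^sub>C\<close> 75)
  is "\<lambda>c x n. c * x n"
  by (simp add: norm_mult summable_mult)

text \<open>Complex span, complex subspaces, etc. of \<open>\<ell>\<^sub>1\<close> are \<open>ell1.span\<close>, \<open>ell1.subspace\<close>, \dots\<close>

global_interpretation ell1: vector_space scaleC_ell1
  by standard (transfer, simp add: algebra_simps)+

lift_definition basis_ell1 :: "nat \<Rightarrow> ell1" is "\<lambda>j n. if n = j then 1 else 0"
proof -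
  fix j :: nat
  show "summable (\<lambda>n. norm (if n = j then 1 else 0 :: complex))"
    by (rule summable_finite[of "{j}"]) auto
qed

definition infinite_dim_ell1 :: "ell1 set \<Rightarrow> bool"
  where "infinite_dim_ell1 V \<longleftrightarrow> \<not> (\<exists>B. finite B \<and> V \<subseteq> ell1.span B)"

text \<open>The library type of bounded operators consists of the real-linear ones, so
  complex linearity is imposed separately. The norm of a complex-linear operator or functional
  is its operator norm in the library sense.\<close>

definition clinear_op :: "(ell1 \<Rightarrow>\<^sub>L ell1) \<Rightarrow> bool"
  where "clinear_op T \<longleftrightarrow> Vector_Spaces.linear scaleC_ell1 scaleC_ell1 (blinfun_apply T)"

definition dual_ell1 :: "(ell1 \<Rightarrow>\<^sub>L complex) set"
  where "dual_ell1 = {\<phi>. Vector_Spaces.linear scaleC_ell1 (*) (blinfun_apply \<phi>)}"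

definition adjoint_ell1 :: "(ell1 \<Rightarrow>\<^sub>L ell1) \<Rightarrow> (ell1 \<Rightarrow>\<^sub>L complex) \<Rightarrow> (ell1 \<Rightarrow>\<^sub>L complex)"
  where "adjoint_ell1 T \<phi> = \<phi> o\<^sub>L T"

text \<open>\<open>blinfun_mult_right c o\<^sub>L \<phi>\<close> is the functional \<open>x \<mapsto> c * \<phi> x\<close>.\<close>

definition isometry_dual :: "((ell1 \<Rightarrow>\<^sub>L complex) \<Rightarrow> (ell1 \<Rightarrow>\<^sub>L complex)) \<Rightarrow> bool"
  where "isometry_dual S \<longleftrightarrow>
    S ` dual_ell1 \<subseteq> dual_ell1 \<and>
    (\<forall>\<phi>\<in>dual_ell1. \<forall>\<psi>\<in>dual_ell1. S (\<phi> + \<psi>) = S \<phi> + S \<psi>) \<and>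
    (\<forall>c. \<forall>\<phi>\<in>dual_ell1. S (blinfun_mult_right c o\<^sub>L \<phi>) = blinfun_mult_right c o\<^sub>L S \<phi>) \<and>
    (\<forall>\<phi>\<in>dual_ell1. norm (S \<phi>) = norm \<phi>)"

definition nontrivial_invariant_subspace :: "(ell1 \<Rightarrow>\<^sub>L ell1) \<Rightarrow> ell1 set \<Rightarrow> bool"
  where "nontrivial_invariant_subspace T E \<longleftrightarrow>
    ell1.subspace E \<and> closed E \<and> E \<noteq> {0} \<and> E \<noteq> UNIV \<and> blinfun_apply T ` E \<subseteq> E"

definition contractions :: "(ell1 \<Rightarrow>\<^sub>L ell1) set"
  where "contractions = {T. clinear_op T \<and> norm T \<le> 1}"

definition T1 :: "(ell1 \<Rightarrow>\<^sub>L ell1) set"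
  where "T1 = {T \<in> contractions. \<forall>j.
    blinfun_apply T (basis_ell1 j) \<in> closure (ell1.span (basis_ell1 ` {..Suc j})) \<and>
    coord (blinfun_apply T (basis_ell1 j)) (Suc j) \<in> \<real> \<and>
    Re (coord (blinfun_apply T (basis_ell1 j)) (Suc j)) > 0}"

definition comeager_in :: "'a topology \<Rightarrow> 'a set \<Rightarrow> bool"
  where "comeager_in X A \<longleftrightarrow> A \<subseteq> topspace X \<and>
    (\<exists>U :: nat \<Rightarrow> 'a set.
      (\<forall>n. openin X (U n) \<and> X closure_of (U n) = topspace X) \<and> (\<Inter>n. U n) \<subseteq> A)"

definition typical_T1 :: "((ell1 \<Rightarrow>\<^sub>L ell1) \<Rightarrow> bool) \<Rightarrow> bool"
  where "typical_T1 P \<longleftrightarrow>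
    comeager_in (subtopology strong_operator_topology T1) {T \<in> T1. P T}"

end

theory Submission
  imports Defs
begin

text \<open>A typical \<open>T\<close> has, for every \<open>k\<close>, columns \<open>T e\<^sub>j\<close> with arbitrarily large \<open>j\<close> arbitrarily
  close to \<open>e\<^sub>k\<close>: this is a \<open>G\<^sub>\<delta>\<close> condition, and it is dense because the columns of an operator on
  \<open>\<ell>\<^sub>1\<close> can be changed independently and a change of the \<open>n\<close>-th column is SOT-small for large
  \<open>n\<close>. For such \<open>T\<close> and every \<open>N\<close>, the image of the unit ball of \<open>{x. x\<^sub>i = 0 for i < N}\<close> is
  dense in the unit ball. Hence \<open>T\<^sup>*\<close> is isometric, and for \<open>\<bar>\<mu>\<bar> < 1\<close> successive approximation
  shows that \<open>T - \<mu>\<close> maps this subspace of codimension \<open>N\<close> onto \<open>\<ell>\<^sub>1\<close>, so that its kernel has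
  dimension at least \<open>N\<close>.\<close>

section \<open>Coordinates, norms and truncations in \<open>ell1\<close>\<close>

lemma coord_simps [simp]:
  "coord 0 n = 0" "coord (x + y) n = coord x n + coord y n"
  "coord (x - y) n = coord x n - coord y n" "coord (- x) n = - coord x n"
  "coord (r *\<^sub>R x) n = r *\<^sub>R coord x n" "coord (c *\<^sub>C x) n = c * coord x n"
  "coord (basis_ell1 j) n = (if n = j then 1 else 0)"
  by (simp_all add: zero_ell1.rep_eq plus_ell1.rep_eq minus_ell1.rep_eq uminus_ell1.rep_eq
      scaleR_ell1.rep_eq scaleC_ell1.rep_eq basis_ell1.rep_eq)

lemma coord_sum [simp]: "coord (sum f A) n = (\<Sum>a\<in>A. coord (f a) n)"
  by (induction A rule: infinite_finite_induct) auto

lemma norm_coord_le: "norm (coord x n) \<le> norm x"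
  unfolding norm_ell1_def using sum_le_suminf[OF summable_coord, of "{n}" x] by simp

lemma norm_scaleC: "norm (c *\<^sub>C x) = norm c * norm x"
  by (simp add: norm_ell1_def norm_mult suminf_mult summable_coord)

lemma norm_basis_ell1 [simp]: "norm (basis_ell1 j) = 1"
proof -
  have "(\<Sum>n. norm (if n = j then 1 else 0 :: complex)) =
        (\<Sum>n\<in>{j}. norm (if n = j then 1 else 0 :: complex))"
    by (rule suminf_finite) auto
  then show ?thesis by (simp add: norm_ell1_def)
qed

text \<open>The norm is additive over disjoint supports. This exact equality, not just an
  inequality, is what later leaves room for an arbitrary new column.\<close>

lemma norm_diff_coord:
  "norm (x - coord x n *\<^sub>C basis_ell1 n) = norm x - norm (coord x n)"
proof -
  have "(\<lambda>m. if m = n then norm (coord x m) else 0) sums norm (coord x n)"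
    by (rule sums_single)
  moreover have "(\<lambda>m. norm (coord x m)) sums norm x"
    unfolding norm_ell1_def by (rule summable_sums[OF summable_coord])
  ultimately have "(\<lambda>m. norm (coord x m) - (if m = n then norm (coord x m) else 0))
      sums (norm x - norm (coord x n))"
    by (intro sums_diff)
  moreover have "(\<lambda>m. norm (coord x m) - (if m = n then norm (coord x m) else 0)) =
      (\<lambda>m. norm (coord (x - coord x n *\<^sub>C basis_ell1 n) m))"
    by auto
  ultimately show ?thesis
    unfolding norm_ell1_def by (simp add: sums_iff)
qed

lemma norm_diff_truncation:
  "norm (x - (\<Sum>k<M. coord x k *\<^sub>C basis_ell1 k)) = norm x - (\<Sum>k<M. norm (coord x k))"
proof (induction M)
  case (Suc M)
  have "coord (x - (\<Sum>k<M. coord x k *\<^sub>C basis_ell1 k)) M = coord x M"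
    by (simp add: sum.If_cases if_distrib cong: if_cong)
  then show ?case
    using norm_diff_coord[of "x - (\<Sum>k<M. coord x k *\<^sub>C basis_ell1 k)" M] Suc
    by (simp add: algebra_simps)
qed simp

lemma truncation_tendsto: "(\<lambda>M. \<Sum>k<M. coord x k *\<^sub>C basis_ell1 k) \<longlonglongrightarrow> x"
proof -
  have "(\<lambda>M. norm x - (\<Sum>k<M. norm (coord x k))) \<longlonglongrightarrow> norm x - norm x"
    using summable_LIMSEQ[OF summable_coord[of x]]
    by (intro tendsto_diff tendsto_const) (simp add: norm_ell1_def)
  then have "(\<lambda>M. dist (\<Sum>k<M. coord x k *\<^sub>C basis_ell1 k) x) \<longlonglongrightarrow> 0"
    by (simp add: dist_norm norm_minus_commute[of _ x] norm_diff_truncation)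
  then show ?thesis
    using tendsto_dist_iff by blast
qed

section \<open>Completeness of \<open>ell1\<close>\<close>

instance ell1 :: banach
proof
  fix X :: "nat \<Rightarrow> ell1"
  assume X: "Cauchy X"
  have "Cauchy (\<lambda>m. coord (X m) n)" for n
  proof (rule metric_CauchyI)
    fix e :: real assume "e > 0"
    then obtain M where M: "\<And>m m'. m \<ge> M \<Longrightarrow> m' \<ge> M \<Longrightarrow> dist (X m) (X m') < e"
      using X unfolding Cauchy_def by blast
    have "dist (coord (X m) n) (coord (X m') n) \<le> dist (X m) (X m')" for m m'
      using norm_coord_le[of "X m - X m'" n] by (simp add: dist_norm)
    with M show "\<exists>M. \<forall>m\<ge>M. \<forall>m'\<ge>M. dist (coord (X m) n) (coord (X m') n) < e"
      using le_less_trans by blast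
  qed
  then have "\<forall>n. \<exists>a. (\<lambda>m. coord (X m) n) \<longlonglongrightarrow> a"
    by (simp add: Cauchy_convergent_iff convergent_def)
  then obtain l where l: "\<And>n. (\<lambda>m. coord (X m) n) \<longlonglongrightarrow> l n"
    by metis
  \<comment> \<open>Coordinatewise limits pass through finite sums only, so the Cauchy estimate is
    carried to the limit on partial sums, uniformly in \<open>N\<close>, before summability is
    known.\<close>
  have partial: "\<exists>M. \<forall>m\<ge>M. \<forall>N. (\<Sum>n<N. norm (coord (X m) n - l n)) \<le> e" if "e > 0" for e
  proof -
    obtain M where M: "\<And>m m'. m \<ge> M \<Longrightarrow> m' \<ge> M \<Longrightarrow> dist (X m) (X m') < e"
      using X \<open>e > 0\<close> unfolding Cauchy_def by blast
    have "(\<Sum>n<N. norm (coord (X m) n - l n)) \<le> e" if "m \<ge> M" for m N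
    proof (rule tendsto_upperbound)
      show "(\<lambda>m'. \<Sum>n<N. norm (coord (X m) n - coord (X m') n)) \<longlonglongrightarrow>
          (\<Sum>n<N. norm (coord (X m) n - l n))"
        by (intro tendsto_intros l)
      have "(\<Sum>n<N. norm (coord (X m) n - coord (X m') n)) \<le> e" if "m' \<ge> M" for m'
      proof -
        have "(\<Sum>n<N. norm (coord (X m) n - coord (X m') n)) \<le> norm (X m - X m')"
          unfolding norm_ell1_def
          using sum_le_suminf[OF summable_coord, of "{..<N}" "X m - X m'"] by simp
        also have "\<dots> \<le> e"
          using M[OF \<open>m \<ge> M\<close> that] by (simp add: dist_norm)
        finally show ?thesis .
      qed
      then show "\<forall>\<^sub>F m' in sequentially.
          (\<Sum>n<N. norm (coord (X m) n - coord (X m') n)) \<le> e"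
        using eventually_sequentially by blast
    qed simp
    then show ?thesis by blast
  qed
  have summ: "\<exists>M. \<forall>m\<ge>M. summable (\<lambda>n. norm (coord (X m) n - l n)) \<and>
      (\<Sum>n. norm (coord (X m) n - l n)) \<le> e" if "e > 0" for e
  proof -
    obtain M where M: "\<And>m N. m \<ge> M \<Longrightarrow> (\<Sum>n<N. norm (coord (X m) n - l n)) \<le> e"
      using partial[OF \<open>e > 0\<close>] by blast
    have "summable (\<lambda>n. norm (coord (X m) n - l n))" if "m \<ge> M" for m
      by (rule bounded_imp_summable[of _ e])
         (use M[OF that, of "Suc _"] in \<open>simp_all add: lessThan_Suc_atMost\<close>)
    then have "summable (\<lambda>n. norm (coord (X m) n - l n)) \<and>
        (\<Sum>n. norm (coord (X m) n - l n)) \<le> e" if "m \<ge> M" for m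
      using suminf_le_const[OF _ M[OF that]] that by simp
    then show ?thesis by blast
  qed
  \<comment> \<open>A single index suffices: \<open>l\<close> is then the difference of the two
    absolutely summable sequences \<open>coord (X m)\<close> and
    \<open>coord (X m) - l\<close>.\<close>
  obtain m where m: "summable (\<lambda>n. norm (coord (X m) n - l n))"
    using summ[of 1] by auto
  have "summable (\<lambda>n. norm (coord (X m) n - (coord (X m) n - l n)))"
    using summable_norm_add[OF summable_coord[of "X m"], of "\<lambda>n. - (coord (X m) n - l n)"] m
    by simp (simp add: norm_minus_commute)
  then have sl: "summable (\<lambda>n. norm (l n))" by simp
  define x where "x = Abs_ell1 l"
  have x: "coord x = l"
    unfolding x_def using sl by (simp add: Abs_ell1_inverse)
  have "X \<longlonglongrightarrow> x"
  proof (rule metric_LIMSEQ_I)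
    fix e :: real assume "e > 0"
    then obtain M where "\<And>m. m \<ge> M \<Longrightarrow> (\<Sum>n. norm (coord (X m) n - l n)) \<le> e / 2"
      using summ[of "e / 2"] by auto
    then have "dist (X m) x < e" if "m \<ge> M" for m
      using that \<open>e > 0\<close> by (fastforce simp: dist_norm norm_ell1_def x)
    then show "\<exists>M. \<forall>m\<ge>M. dist (X m) x < e" by blast
  qed
  then show "convergent X" by (rule convergentI)
qed

section \<open>Complex-linear maps and successive approximation\<close>

lemma bounded_linear_coord: "bounded_linear (\<lambda>x. coord x n)"
  by (rule bounded_linear_intro[of _ 1]) (simp_all add: norm_coord_le)

lemma bounded_linear_scaleC: "bounded_linear (\<lambda>x. c *\<^sub>C x)"
  by (rule bounded_linear_intro[of _ "norm c"])
     (auto intro: ell1_eqI simp: norm_scaleC algebra_simps)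

text \<open>Additivity is built into bounded operators, so only complex homogeneity remains to be
  checked.\<close>

lemma clinear_op_iff:
  "clinear_op T \<longleftrightarrow> (\<forall>c x. blinfun_apply T (c *\<^sub>C x) = c *\<^sub>C blinfun_apply T x)"
  unfolding clinear_op_def Vector_Spaces.linear_iff_module_hom module_hom_iff
  using ell1.module_axioms by (auto simp: blinfun.add_right)

lemma dual_ell1_iff:
  "\<phi> \<in> dual_ell1 \<longleftrightarrow> (\<forall>c x. blinfun_apply \<phi> (c *\<^sub>C x) = c * blinfun_apply \<phi> x)"
proof -
  have "module ((*) :: complex \<Rightarrow> complex \<Rightarrow> complex)"
    by standard (auto simp: algebra_simps)
  then show ?thesis
    unfolding dual_ell1_def Vector_Spaces.linear_iff_module_hom module_hom_iff
    using ell1.module_axioms by (auto simp: blinfun.add_right)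
qed

text \<open>Solve approximately, then solve again for the residual: residuals decay like
  \<open>r ^ n\<close>, so the corrections form an absolutely convergent series, whose sum stays in
  the closed subspace \<open>V\<close>.\<close>

lemma approx_solvable_imp_solvable:
  fixes A :: "'a::banach \<Rightarrow> 'b::real_normed_vector"
  assumes A: "bounded_linear A" and V: "closed V" "subspace V" and r: "0 \<le> r" "r < 1"
    and approx: "\<And>y. \<exists>x\<in>V. norm x \<le> norm y \<and> norm (y - A x) \<le> r * norm y"
  shows "\<exists>x\<in>V. A x = y"
proof -
  obtain g where g: "\<And>y. g y \<in> V" "\<And>y. norm (g y) \<le> norm y"
      "\<And>y. norm (y - A (g y)) \<le> r * norm y"
    using approx by metis
  define Y where "Y n = ((\<lambda>z. z - A (g z)) ^^ n) y" for n
  have Y: "Y 0 = y" "Y (Suc n) = Y n - A (g (Y n))" for n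
    by (simp_all add: Y_def)
  have nY: "norm (Y n) \<le> r ^ n * norm y" for n
  proof (induction n)
    case (Suc n)
    have "norm (Y (Suc n)) \<le> r * norm (Y n)"
      using g(3) Y by simp
    also have "\<dots> \<le> r * (r ^ n * norm y)"
      using Suc r by (intro mult_left_mono) auto
    finally show ?case by (simp add: mult.assoc)
  qed (simp add: Y)
  have gs: "summable (\<lambda>n. r ^ n * norm y)"
    using r by (intro summable_mult2 summable_geometric) auto
  have s: "summable (\<lambda>n. g (Y n))"
    by (rule summable_comparison_test'[OF gs, of 0]) (use g(2) nY order_trans in blast)
  have Y0: "Y \<longlonglongrightarrow> 0"
    by (rule Lim_null_comparison[OF always_eventually summable_LIMSEQ_zero[OF gs]])
       (use nY in auto)
  \<comment> \<open>The images of the corrections are the successive drops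
    \<open>Y n - Y (Suc n)\<close> of the residual, so their sum telescopes to
    \<open>Y 0 = y\<close>.\<close>
  have "(\<lambda>n. Y (Suc n) - Y n) sums (0 - Y 0)"
    by (rule telescope_sums[OF Y0])
  then have "(\<lambda>n. A (g (Y n))) sums y"
    using sums_minus[of "\<lambda>n. Y (Suc n) - Y n"] by (fastforce simp: Y)
  moreover have "(\<lambda>n. A (g (Y n))) sums A (\<Sum>n. g (Y n))"
    using bounded_linear.sums[OF A summable_sums[OF s]] .
  ultimately have "A (\<Sum>n. g (Y n)) = y"
    using sums_unique2 by blast
  moreover have "(\<Sum>n. g (Y n)) \<in> V"
    by (rule closed_sequentially[OF V(1) _ summable_LIMSEQ[OF s]])
       (use g(1) V(2) in \<open>auto intro: subspace_sum\<close>)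
  ultimately show ?thesis by blast
qed

section \<open>Columns near basis vectors: openness and density in the strong operator
  topology\<close>

definition column_near_basis :: "nat \<Rightarrow> nat \<Rightarrow> real \<Rightarrow> (ell1 \<Rightarrow>\<^sub>L ell1) set"
  where "column_near_basis k N \<epsilon> =
    (\<Union>j\<in>{N..}. {T. norm (blinfun_apply T (basis_ell1 j) - basis_ell1 k) < \<epsilon>})"

lemma openin_column_near_basis: "openin strong_operator_topology (column_near_basis k N \<epsilon>)"
proof -
  have "openin strong_operator_topology
      {T. norm (blinfun_apply T (basis_ell1 j) - basis_ell1 k) < \<epsilon>}" for j
    using openin_continuous_map_preimage[OF
        strong_operator_topology_continuous_evaluation[of "basis_ell1 j"], of "ball (basis_ell1 k) \<epsilon>"]
    by (simp add: strong_operator_topology_topspace dist_norm norm_minus_commute)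
  then show ?thesis
    unfolding column_near_basis_def by (auto intro: openin_Union)
qed

text \<open>The topology is pulled back from the product topology, so a basic neighbourhood
  constrains an operator at finitely many vectors only, and pointwise convergence handles these
  simultaneously.\<close>

lemma eventually_in_sot_open:
  fixes S :: "nat \<Rightarrow> ('a::real_normed_vector \<Rightarrow>\<^sub>L 'b::real_normed_vector)"
  assumes W: "openin strong_operator_topology W" "T \<in> W"
    and lim: "\<And>x. (\<lambda>n. blinfun_apply (S n) x) \<longlonglongrightarrow> blinfun_apply T x"
  shows "\<forall>\<^sub>F n in sequentially. S n \<in> W"
proof -
  obtain U where U: "open U" "W = blinfun_apply -` U"
    using W(1) unfolding strong_operator_topology_def openin_pullback_topology by auto
  obtain B where B: "blinfun_apply T \<in> Pi\<^sub>E UNIV B" "\<And>x. open (B x)"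
      "finite {x. B x \<noteq> UNIV}" "Pi\<^sub>E UNIV B \<subseteq> U"
    using product_topology_open_contains_basis[of "\<lambda>_. euclidean" UNIV U "blinfun_apply T"] U W(2)
    by (auto simp: euclidean_product_topology)
  have "\<forall>\<^sub>F n in sequentially. \<forall>x\<in>{x. B x \<noteq> UNIV}. blinfun_apply (S n) x \<in> B x"
    by (rule eventually_ball_finite[OF B(3)]) (use B lim topological_tendstoD in blast)
  then show ?thesis
  proof eventually_elim
    case (elim n)
    then have "blinfun_apply (S n) \<in> Pi\<^sub>E UNIV B" by auto
    with B U show ?case by auto
  qed
qed

text \<open>Since the norm of an operator on \<open>\<ell>\<^sub>1\<close> is the supremum of the norms of its columns, any
  column may be replaced by an arbitrary vector of the unit ball.\<close>

lemma replace_column: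
  assumes T: "T \<in> contractions" and v: "norm v \<le> 1"
  obtains S where "S \<in> contractions"
    "\<And>x. blinfun_apply S x = blinfun_apply T (x - coord x n *\<^sub>C basis_ell1 n) + coord x n *\<^sub>C v"
proof -
  let ?f = "\<lambda>x. blinfun_apply T (x - coord x n *\<^sub>C basis_ell1 n) + coord x n *\<^sub>C v"
  have Tc: "blinfun_apply T (c *\<^sub>C x) = c *\<^sub>C blinfun_apply T x" for c x
    using T by (auto simp: contractions_def clinear_op_iff)
  \<comment> \<open>Removing the \<open>n\<close>-th coordinate frees exactly
    \<open>norm (coord x n)\<close> of the norm, and the new column contributes at most that
    much.\<close>
  have le: "norm (?f x) \<le> norm x" for x
  proof -
    have "norm (?f x) \<le> norm T * norm (x - coord x n *\<^sub>C basis_ell1 n) + norm (coord x n) * norm v"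
      by (intro order_trans[OF norm_triangle_ineq] add_mono norm_blinfun) (simp add: norm_scaleC)
    also have "\<dots> \<le> 1 * (norm x - norm (coord x n)) + norm (coord x n) * 1"
      unfolding norm_diff_coord using T v norm_coord_le[of x n]
      by (intro add_mono mult_mono) (auto simp: contractions_def)
    finally show ?thesis by simp
  qed
  have "bounded_linear ?f"
  proof (rule bounded_linear_intro[of _ 1])
    fix x y :: ell1 and r :: real
    show "?f (x + y) = ?f x + ?f y"
      by (auto intro!: ell1_eqI simp: blinfun.add_right blinfun.diff_right Tc algebra_simps)
    show "?f (r *\<^sub>R x) = r *\<^sub>R ?f x"
      by (auto intro!: ell1_eqI
          simp: blinfun.scaleR_right blinfun.diff_right Tc algebra_simps scaleR_conv_of_real)
  qed (use le in simp)
  then have S: "blinfun_apply (Blinfun ?f) = ?f" by (rule bounded_linear_Blinfun_apply)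
  have "clinear_op (Blinfun ?f)"
    unfolding clinear_op_iff S
    by (auto intro!: ell1_eqI simp: blinfun.diff_right Tc algebra_simps)
  moreover have "norm (Blinfun ?f) \<le> 1"
    by (rule norm_blinfun_bound) (use le in \<open>simp_all add: S\<close>)
  ultimately show ?thesis
    using that[of "Blinfun ?f"] S by (simp add: contractions_def)
qed

text \<open>The new column is a convex combination of \<open>basis_ell1 k\<close> and
  \<open>basis_ell1 (Suc n)\<close>. The small weight on the latter keeps the subdiagonal entry
  positive; \<open>k \<le> n\<close> keeps the column in the permitted span and the two basis
  vectors distinct.\<close>

lemma T1_replace_column:
  assumes T: "T \<in> T1" and "\<epsilon> > 0" "k \<le> n"
  obtains S where "S \<in> T1" "norm (blinfun_apply S (basis_ell1 n) - basis_ell1 k) < \<epsilon>"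
    "\<And>x. norm (blinfun_apply S x - blinfun_apply T x) \<le> 2 * norm (coord x n)"
proof -
  \<comment> \<open>The bound 1 makes \<open>v\<close> a convex combination;
    \<open>\<epsilon> / 3\<close> gives \<open>2 * c < \<epsilon>\<close>, and \<open>2 * c\<close>
    bounds the distance from \<open>v\<close> to \<open>basis_ell1 k\<close>.\<close>
  define c where "c = min 1 (\<epsilon> / 3)"
  have c: "0 < c" "c \<le> 1" "2 * c < \<epsilon>"
    using \<open>\<epsilon> > 0\<close> by (auto simp: c_def)
  define v where "v = of_real (1 - c) *\<^sub>C basis_ell1 k + of_real c *\<^sub>C basis_ell1 (Suc n)"
  have "norm v \<le> norm (of_real (1 - c) :: complex) + norm (of_real c :: complex)"
    unfolding v_def by (rule order_trans[OF norm_triangle_ineq]) (simp add: norm_scaleC)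
  also have "\<dots> = 1" using c by (simp only: norm_of_real)
  finally have v: "norm v \<le> 1" .
  have Tcon: "T \<in> contractions" using T by (simp add: T1_def)
  obtain S where S: "S \<in> contractions"
    "\<And>x. blinfun_apply S x = blinfun_apply T (x - coord x n *\<^sub>C basis_ell1 n) + coord x n *\<^sub>C v"
    by (rule replace_column[OF Tcon v, where n = n]) blast
  have Tc: "blinfun_apply T (c *\<^sub>C x) = c *\<^sub>C blinfun_apply T x" for c x
    using Tcon by (auto simp: contractions_def clinear_op_iff)
  have Sn: "blinfun_apply S (basis_ell1 n) = v"
    by (simp add: S(2) blinfun.diff_right)
  have Sj: "blinfun_apply S (basis_ell1 j) = blinfun_apply T (basis_ell1 j)" if "j \<noteq> n" for j
    using that by (simp add: S(2))
  have "v \<in> ell1.span (basis_ell1 ` {..Suc n})"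
    unfolding v_def using \<open>k \<le> n\<close>
    by (intro ell1.span_add ell1.span_scale ell1.span_base) auto
  then have "v \<in> closure (ell1.span (basis_ell1 ` {..Suc n}))"
    using closure_subset by blast
  moreover have "coord v (Suc n) = of_real c"
    using \<open>k \<le> n\<close> by (simp add: v_def)
  ultimately have "S \<in> T1"
    unfolding T1_def using S(1) T c(1)
    by (auto simp: T1_def) (metis Sn Sj Re_complex_of_real Reals_of_real)+
  moreover have "norm (blinfun_apply S (basis_ell1 n) - basis_ell1 k) < \<epsilon>"
  proof -
    have "v - basis_ell1 k = of_real c *\<^sub>C (basis_ell1 (Suc n) - basis_ell1 k)"
      by (rule ell1_eqI) (simp add: v_def algebra_simps)
    then have "norm (v - basis_ell1 k) = c * norm (basis_ell1 (Suc n) - basis_ell1 k)"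
      using c by (simp add: norm_scaleC)
    also have "\<dots> \<le> c * 2"
      using c norm_triangle_ineq4[of "basis_ell1 (Suc n)" "basis_ell1 k"]
      by (intro mult_left_mono) auto
    finally show ?thesis using c Sn by simp
  qed
  moreover have "norm (blinfun_apply S x - blinfun_apply T x) \<le> 2 * norm (coord x n)" for x
  proof -
    \<comment> \<open>The difference \<open>S - T\<close> has rank at most one: it only sees the
      \<open>n\<close>-th coordinate, and the old and new columns both lie in the unit ball.\<close>
    have "blinfun_apply S x - blinfun_apply T x =
        coord x n *\<^sub>C (v - blinfun_apply T (basis_ell1 n))"
      by (rule ell1_eqI) (simp add: S(2) blinfun.diff_right Tc algebra_simps)
    then have "norm (blinfun_apply S x - blinfun_apply T x) =
        norm (coord x n) * norm (v - blinfun_apply T (basis_ell1 n))"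
      by (simp add: norm_scaleC)
    also have "\<dots> \<le> norm (coord x n) * 2"
    proof (rule mult_left_mono)
      have "norm (blinfun_apply T (basis_ell1 n)) \<le> 1"
        using norm_blinfun[of T "basis_ell1 n"] Tcon by (simp add: contractions_def)
      then show "norm (v - blinfun_apply T (basis_ell1 n)) \<le> 2"
        using v norm_triangle_ineq4[of v "blinfun_apply T (basis_ell1 n)"] by simp
    qed simp
    finally show ?thesis by simp
  qed
  ultimately show ?thesis using that by blast
qed

text \<open>Replacing ever later columns perturbs the value at \<open>x\<close> by at most twice a
  coordinate of \<open>x\<close> that tends to 0, so the perturbed operators converge to
  \<open>T\<close> pointwise.\<close>

lemma dense_column_near_basis:
  assumes "\<epsilon> > 0"
  shows "subtopology strong_operator_topology T1 closure_of (T1 \<inter> column_near_basis k N \<epsilon>) = T1"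
proof -
  have "T \<in> subtopology strong_operator_topology T1 closure_of (T1 \<inter> column_near_basis k N \<epsilon>)"
    if T: "T \<in> T1" for T
    unfolding in_closure_of
  proof (intro conjI allI impI)
    show "T \<in> topspace (subtopology strong_operator_topology T1)"
      using T by (simp add: strong_operator_topology_topspace)
    fix W assume "T \<in> W \<and> openin (subtopology strong_operator_topology T1) W"
    then obtain W' where W': "openin strong_operator_topology W'" "W = W' \<inter> T1" "T \<in> W'"
      by (auto simp: openin_subtopology)
    \<comment> \<open>The shift by \<open>k\<close> ensures that the replaced column has index at
      least \<open>k\<close>, as the replacement requires.\<close>
    have "\<exists>S. S \<in> T1 \<and> norm (blinfun_apply S (basis_ell1 (n + k)) - basis_ell1 k) < \<epsilon> \<and>
        (\<forall>x. norm (blinfun_apply S x - blinfun_apply T x) \<le> 2 * norm (coord x (n + k)))" for n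
      by (rule T1_replace_column[OF T assms, of k "n + k"]) auto
    then obtain S where S: "\<And>n. S n \<in> T1"
        "\<And>n. norm (blinfun_apply (S n) (basis_ell1 (n + k)) - basis_ell1 k) < \<epsilon>"
        "\<And>n x. norm (blinfun_apply (S n) x - blinfun_apply T x) \<le> 2 * norm (coord x (n + k))"
      by metis
    have "(\<lambda>n. blinfun_apply (S n) x) \<longlonglongrightarrow> blinfun_apply T x" for x
    proof -
      have "(\<lambda>n. norm (coord x (n + k))) \<longlonglongrightarrow> 0"
        by (intro LIMSEQ_ignore_initial_segment summable_LIMSEQ_zero summable_coord)
      then have "(\<lambda>n. 2 * norm (coord x (n + k))) \<longlonglongrightarrow> 0"
        by (rule tendsto_mult_right_zero)
      then have "(\<lambda>n. blinfun_apply (S n) x - blinfun_apply T x) \<longlonglongrightarrow> 0"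
        by (rule Lim_null_comparison[OF always_eventually, rotated]) (simp add: S(3))
      then show ?thesis by (simp add: LIM_zero_iff)
    qed
    then have "\<forall>\<^sub>F n in sequentially. S n \<in> W'"
      by (rule eventually_in_sot_open[OF W'(1,3)])
    then obtain n where n: "n \<ge> N" "S n \<in> W'"
      unfolding eventually_sequentially by (meson nat_le_linear)
    then have "S n \<in> column_near_basis k N \<epsilon>"
      using S(2)[of n] unfolding column_near_basis_def by (auto intro!: bexI[of _ "n + k"])
    with n S(1) W' show "\<exists>y. y \<in> T1 \<inter> column_near_basis k N \<epsilon> \<and> y \<in> W"
      by blast
  qed
  moreover have "subtopology strong_operator_topology T1 closure_of
      (T1 \<inter> column_near_basis k N \<epsilon>) \<subseteq> T1"
    using closure_of_subset_topspace by fastforce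
  ultimately show ?thesis by blast
qed

section \<open>Comeagerness of the operators with recurrent columns\<close>

definition recurrent_columns :: "(ell1 \<Rightarrow>\<^sub>L ell1) \<Rightarrow> bool"
  where "recurrent_columns T \<longleftrightarrow>
    (\<forall>k N \<epsilon>. \<epsilon> > 0 \<longrightarrow> (\<exists>j\<ge>N. norm (blinfun_apply T (basis_ell1 j) - basis_ell1 k) < \<epsilon>))"

lemma typical_recurrent_columns: "typical_T1 recurrent_columns"
proof -
  \<comment> \<open>Nested pair decoding enumerates all triples \<open>(k, N, m)\<close>; the
    tolerances \<open>1 / Suc m\<close> stand in for all positive \<epsilon>, which makes the
    intersection countable.\<close>
  define V where "V n = (case prod_decode n of (k, p) \<Rightarrow> case prod_decode p of (N, m) \<Rightarrow>
    T1 \<inter> column_near_basis k N (1 / Suc m))" for n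
  have V: "V (prod_encode (k, prod_encode (N, m))) = T1 \<inter> column_near_basis k N (1 / Suc m)"
    for k N m
    by (simp add: V_def)
  have "recurrent_columns T" if T: "T \<in> (\<Inter>n. V n)" for T
    unfolding recurrent_columns_def
  proof (intro allI impI)
    fix k N and \<epsilon> :: real assume "\<epsilon> > 0"
    then obtain m where m: "1 / Suc m < \<epsilon>"
      using nat_approx_posE by blast
    have "T \<in> column_near_basis k N (1 / Suc m)"
      using T V by blast
    with m show "\<exists>j\<ge>N. norm (blinfun_apply T (basis_ell1 j) - basis_ell1 k) < \<epsilon>"
      unfolding column_near_basis_def using order.strict_trans by force
  qed
  moreover have "(\<Inter>n. V n) \<subseteq> T1"
    using V by blast
  moreover have "openin (subtopology strong_operator_topology T1) (V n)" for n
    unfolding V_def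
    by (auto split: prod.split intro!: openin_subtopology_Int2 openin_column_near_basis)
  moreover have "subtopology strong_operator_topology T1 closure_of V n =
      topspace (subtopology strong_operator_topology T1)" for n
    unfolding V_def
    by (auto split: prod.split simp: dense_column_near_basis strong_operator_topology_topspace)
  ultimately show ?thesis
    unfolding typical_T1_def comeager_in_def
    by (auto simp: strong_operator_topology_topspace intro!: exI[of _ V])
qed

lemma typical_T1_mono:
  assumes "typical_T1 P" "\<And>T. T \<in> T1 \<Longrightarrow> P T \<Longrightarrow> Q T"
  shows "typical_T1 Q"
proof -
  have "{T \<in> T1. P T} \<subseteq> {T \<in> T1. Q T}"
    using assms(2) by blast
  moreover have "{T \<in> T1. Q T} \<subseteq> topspace (subtopology strong_operator_topology T1)"
    by (auto simp: strong_operator_topology_topspace)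
  ultimately show ?thesis
    using assms(1) unfolding typical_T1_def comeager_in_def by (meson order_trans)
qed

section \<open>Surjectivity, kernels and adjoint of a contraction with recurrent columns\<close>

definition tail_space :: "nat \<Rightarrow> ell1 set"
  where "tail_space N = {x. \<forall>n<N. coord x n = 0}"

lemma closed_tail_space: "closed (tail_space N)"
proof -
  have "tail_space N = (\<Inter>n\<in>{..<N}. {x. coord x n = 0})"
    by (auto simp: tail_space_def)
  moreover have "closed {x. coord x n = 0}" for n
    by (intro closed_Collect_eq continuous_on_const linear_continuous_on bounded_linear_coord)
  ultimately show ?thesis by auto
qed

lemma subspace_tail_space: "subspace (tail_space N)"
  by (auto simp: subspace_def tail_space_def)

locale recurrent_contraction =
  fixes T :: "ell1 \<Rightarrow>\<^sub>L ell1"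
  assumes contraction: "T \<in> contractions" and recurrent: "recurrent_columns T"
begin

lemma apply_scaleC: "blinfun_apply T (c *\<^sub>C x) = c *\<^sub>C blinfun_apply T x"
  using contraction by (auto simp: contractions_def clinear_op_iff)

text \<open>Truncate \<open>y\<close> and replace each \<open>basis_ell1 k\<close> by some
  \<open>basis_ell1 (J k)\<close> whose image is close to \<open>basis_ell1 k\<close>. The
  coefficients are kept, so the norm does not grow, and \<open>J k \<ge> N\<close> puts the result
  in the tail space.\<close>

lemma approx_preimage:
  assumes "\<delta> > 0"
  shows "\<exists>x\<in>tail_space N. norm x \<le> norm y \<and> norm (y - blinfun_apply T x) \<le> \<delta>"
proof -
  obtain M where M: "norm (y - (\<Sum>k<M. coord y k *\<^sub>C basis_ell1 k)) < \<delta> / 2"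
  proof -
    have "\<forall>\<^sub>F M in sequentially. dist (\<Sum>k<M. coord y k *\<^sub>C basis_ell1 k) y < \<delta> / 2"
      using truncation_tendsto[of y] assms by (intro tendstoD) auto
    then show ?thesis
      using that by (auto simp: eventually_sequentially dist_norm norm_minus_commute)
  qed
  \<comment> \<open>The column errors are weighted by the coefficients of \<open>y\<close>, so they
    total at most \<open>norm y * \<epsilon>\<close>; adding 1 in the denominator covers
    \<open>y = 0\<close>.\<close>
  define \<epsilon> where "\<epsilon> = \<delta> / (2 * (norm y + 1))"
  have \<epsilon>: "\<epsilon> > 0" "norm y * \<epsilon> \<le> \<delta> / 2"
    using assms by (auto simp: \<epsilon>_def field_simps add_pos_nonneg)
  have "\<forall>k. \<exists>j\<ge>N. norm (blinfun_apply T (basis_ell1 j) - basis_ell1 k) < \<epsilon>"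
    using recurrent \<epsilon>(1) by (simp add: recurrent_columns_def)
  then obtain J where J: "\<And>k. J k \<ge> N"
      "\<And>k. norm (blinfun_apply T (basis_ell1 (J k)) - basis_ell1 k) < \<epsilon>"
    by metis
  define x where "x = (\<Sum>k<M. coord y k *\<^sub>C basis_ell1 (J k))"
  have sum_le: "(\<Sum>k<M. norm (coord y k)) \<le> norm y"
    unfolding norm_ell1_def by (rule sum_le_suminf[OF summable_coord]) auto
  have "x \<in> tail_space N"
    unfolding x_def using J(1) by (auto simp: tail_space_def not_less[symmetric] intro!: sum.neutral)
  moreover have "norm x \<le> norm y"
    using sum_le unfolding x_def
    by (intro order_trans[OF norm_sum]) (simp add: norm_scaleC)
  moreover have "norm (y - blinfun_apply T x) \<le> \<delta>"
  proof -
    have "(\<Sum>k<M. coord y k *\<^sub>C basis_ell1 k) - blinfun_apply T x =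
        (\<Sum>k<M. coord y k *\<^sub>C (basis_ell1 k - blinfun_apply T (basis_ell1 (J k))))"
      by (simp add: x_def blinfun.sum_right apply_scaleC ell1.scale_right_diff_distrib
          sum_subtractf)
    also have "norm \<dots> \<le> (\<Sum>k<M. norm (coord y k) * \<epsilon>)"
      using J(2) by (intro sum_norm_le)
        (simp add: norm_scaleC norm_minus_commute mult_left_mono less_imp_le)
    also have "\<dots> \<le> norm y * \<epsilon>"
      unfolding sum_distrib_right[symmetric] using sum_le \<epsilon>(1) by (intro mult_right_mono) auto
    finally have "norm ((\<Sum>k<M. coord y k *\<^sub>C basis_ell1 k) - blinfun_apply T x) \<le> \<delta> / 2"
      using \<epsilon>(2) by simp
    with M show ?thesis
      using norm_triangle_ineq[of "y - (\<Sum>k<M. coord y k *\<^sub>C basis_ell1 k)"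
          "(\<Sum>k<M. coord y k *\<^sub>C basis_ell1 k) - blinfun_apply T x"] by simp
  qed
  ultimately show ?thesis by blast
qed

text \<open>An approximate preimage under \<open>T\<close> also works for \<open>T - \<mu>\<close>:
  the extra term costs at most \<open>norm \<mu> * norm y\<close>, and an error of
  \<open>(1 - norm \<mu>) / 2 * norm y\<close> for \<open>T\<close> leaves the contraction factor
  \<open>(1 + norm \<mu>) / 2 < 1\<close>.\<close>

lemma tail_solvable:
  assumes "norm \<mu> < 1"
  shows "\<exists>x\<in>tail_space N. blinfun_apply T x - \<mu> *\<^sub>C x = y"
proof (rule approx_solvable_imp_solvable[of _ _ "(1 + norm \<mu>) / 2"])
  show "bounded_linear (\<lambda>x. blinfun_apply T x - \<mu> *\<^sub>C x)"
    by (intro bounded_linear_sub bounded_linear_scaleC blinfun.bounded_linear_right)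
  fix y :: ell1
  show "\<exists>x\<in>tail_space N. norm x \<le> norm y \<and>
      norm (y - (blinfun_apply T x - \<mu> *\<^sub>C x)) \<le> (1 + norm \<mu>) / 2 * norm y"
  \<comment> \<open>The approximation needs a strictly positive tolerance, which a multiple of
    \<open>norm y\<close> provides only for nonzero \<open>y\<close>.\<close>
  proof (cases "y = 0")
    case True
    then show ?thesis
      by (intro bexI[of _ 0]) (auto simp: tail_space_def)
  next
    case False
    then have "(1 - norm \<mu>) / 2 * norm y > 0"
      using assms by simp
    then obtain x where x: "x \<in> tail_space N" "norm x \<le> norm y"
        "norm (y - blinfun_apply T x) \<le> (1 - norm \<mu>) / 2 * norm y"
      using approx_preimage by blast
    have "norm (y - (blinfun_apply T x - \<mu> *\<^sub>C x)) \<le>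
        norm (y - blinfun_apply T x) + norm (\<mu> *\<^sub>C x)"
      using norm_triangle_ineq[of "y - blinfun_apply T x" "\<mu> *\<^sub>C x"] by (simp add: algebra_simps)
    also have "\<dots> \<le> (1 - norm \<mu>) / 2 * norm y + norm \<mu> * norm y"
      using x by (intro add_mono) (auto simp: norm_scaleC mult_left_mono)
    also have "\<dots> = (1 + norm \<mu>) / 2 * norm y"
      by (simp add: field_simps)
    finally show ?thesis using x by blast
  qed
qed (use assms closed_tail_space subspace_tail_space in auto)

lemma surj_diff_scaleC: "norm \<mu> < 1 \<Longrightarrow> surj (\<lambda>x. blinfun_apply T x - \<mu> *\<^sub>C x)"
  unfolding surj_def using tail_solvable by (metis (no_types))

text \<open>As \<open>T - \<mu>\<close> already maps the subspace of sequences vanishing below \<open>N\<close> onto \<open>\<ell>\<^sub>1\<close>, each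
  of \<open>e\<^sub>0, \<dots>, e\<^bsub>N - 1\<^esub>\<close> can be corrected by an element of that subspace to lie in the kernel.\<close>

lemma kernel_contains_independent:
  assumes "norm \<mu> < 1"
  shows "\<exists>A \<subseteq> {x. blinfun_apply T x - \<mu> *\<^sub>C x = 0}. finite A \<and> card A = N \<and> ell1.independent A"
proof -
  have "\<forall>i. \<exists>x\<in>tail_space N. blinfun_apply T x - \<mu> *\<^sub>C x =
      blinfun_apply T (basis_ell1 i) - \<mu> *\<^sub>C basis_ell1 i"
    using tail_solvable[OF assms] by blast
  then obtain v where v: "\<And>i. v i \<in> tail_space N"
      "\<And>i. blinfun_apply T (v i) - \<mu> *\<^sub>C v i =
         blinfun_apply T (basis_ell1 i) - \<mu> *\<^sub>C basis_ell1 i"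
    by metis
  define f where "f i = basis_ell1 i - v i" for i
  \<comment> \<open>The first \<open>N\<close> coordinates of \<open>f 0, ..., f (N - 1)\<close>
    form the identity matrix, which yields both injectivity and independence.\<close>
  have f: "coord (f i) n = (if n = i then 1 else 0)" if "n < N" for i n
    using that v(1)[of i] by (simp add: f_def tail_space_def)
  have inj: "inj_on f {..<N}"
    by (rule inj_onI) (metis f lessThan_iff zero_neq_one)
  have "ell1.independent (f ` {..<N})"
  proof (rule ell1.independent_if_scalars_zero)
    fix g x assume g: "(\<Sum>x\<in>f ` {..<N}. g x *\<^sub>C x) = 0" and "x \<in> f ` {..<N}"
    then obtain i where i: "i < N" "x = f i" by auto
    have "0 = coord (\<Sum>j<N. g (f j) *\<^sub>C f j) i"
      using g by (simp only: sum.reindex[OF inj] o_def coord_simps)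
    also have "\<dots> = (\<Sum>j<N. if j = i then g (f j) else 0)"
      unfolding coord_sum by (rule sum.cong) (auto simp: f[OF i(1)])
    also have "\<dots> = g x"
      using i by simp
    finally show "g x = 0" by simp
  qed simp
  moreover have "f ` {..<N} \<subseteq> {x. blinfun_apply T x - \<mu> *\<^sub>C x = 0}"
    using v(2) by (auto simp: f_def blinfun.diff_right ell1.scale_right_diff_distrib algebra_simps)
  moreover have "card (f ` {..<N}) = N"
    using card_image[OF inj] by simp
  ultimately show ?thesis by blast
qed

text \<open>The span of a finite \<open>B\<close> contains no independent set of more than
  \<open>card B\<close> vectors, while the kernel contains one of size
  \<open>Suc (card B)\<close>.\<close>

lemma infinite_dim_kernel:
  assumes "norm \<mu> < 1"
  shows "infinite_dim_ell1 {x. blinfun_apply T x - \<mu> *\<^sub>C x = 0}"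
  unfolding infinite_dim_ell1_def
proof (rule notI, elim exE conjE)
  fix B assume B: "finite B" "{x. blinfun_apply T x - \<mu> *\<^sub>C x = 0} \<subseteq> ell1.span B"
  obtain A where "A \<subseteq> {x. blinfun_apply T x - \<mu> *\<^sub>C x = 0}" "card A = Suc (card B)"
      "ell1.independent A"
    using kernel_contains_independent[OF assms] by metis
  then show False
    using ell1.independent_span_bound[OF B(1), of A] B(2) by auto
qed

lemma eigenvector_exists:
  assumes "norm \<mu> < 1"
  shows "\<exists>x. x \<noteq> 0 \<and> blinfun_apply T x = \<mu> *\<^sub>C x"
proof -
  obtain A where "A \<subseteq> {x. blinfun_apply T x - \<mu> *\<^sub>C x = 0}" "card A = 1" "ell1.independent A"
    using kernel_contains_independent[OF assms] by metis
  then show ?thesis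
    by (auto simp: card_1_singleton_iff)
qed

lemma isometry_adjoint: "isometry_dual (adjoint_ell1 T)"
proof -
  \<comment> \<open>One inequality is \<open>norm T \<le> 1\<close>. For the other, every
    \<open>y\<close> is a limit of vectors \<open>T x\<close> with
    \<open>norm x \<le> norm y\<close>, so composing with \<open>T\<close> loses no norm.\<close>
  have "norm (\<phi> o\<^sub>L T) = norm \<phi>" for \<phi> :: "ell1 \<Rightarrow>\<^sub>L complex"
  proof (rule antisym)
    have "norm \<phi> * norm T \<le> norm \<phi> * 1"
      using contraction by (intro mult_left_mono) (auto simp: contractions_def)
    then show "norm (\<phi> o\<^sub>L T) \<le> norm \<phi>"
      using norm_blinfun_compose[of \<phi> T] by simp
    show "norm \<phi> \<le> norm (\<phi> o\<^sub>L T)"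
    proof (rule norm_blinfun_bound)
      fix y
      show "norm (blinfun_apply \<phi> y) \<le> norm (\<phi> o\<^sub>L T) * norm y"
      proof (rule field_le_epsilon)
        fix e :: real assume "e > 0"
        define \<delta> where "\<delta> = e / (norm \<phi> + 1)"
        have \<delta>: "\<delta> > 0" "norm \<phi> * \<delta> \<le> e"
          using \<open>e > 0\<close> by (auto simp: \<delta>_def field_simps add_pos_nonneg)
        obtain x where x: "norm x \<le> norm y" "norm (y - blinfun_apply T x) \<le> \<delta>"
          using approx_preimage[OF \<delta>(1)] by blast
        have "norm (blinfun_apply \<phi> y) =
            norm (blinfun_apply (\<phi> o\<^sub>L T) x + blinfun_apply \<phi> (y - blinfun_apply T x))"
          by (simp add: blinfun.diff_right)
        also have "\<dots> \<le> norm (\<phi> o\<^sub>L T) * norm x + norm \<phi> * norm (y - blinfun_apply T x)"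
          by (intro order_trans[OF norm_triangle_ineq] add_mono norm_blinfun)
        also have "\<dots> \<le> norm (\<phi> o\<^sub>L T) * norm y + norm \<phi> * \<delta>"
          using x by (intro add_mono mult_left_mono) auto
        finally show "norm (blinfun_apply \<phi> y) \<le> norm (\<phi> o\<^sub>L T) * norm y + e"
          using \<delta>(2) by simp
      qed
    qed simp
  qed
  then show ?thesis
    unfolding isometry_dual_def adjoint_ell1_def
    by (auto simp: dual_ell1_iff apply_scaleC blinfun.add_left intro!: blinfun_eqI)
qed

text \<open>Every functional in the range of the adjoint vanishes on the kernel of \<open>T\<close>,
  but some coordinate functional does not vanish at a nonzero kernel vector.\<close>

lemma adjoint_not_surj: "adjoint_ell1 T ` dual_ell1 \<noteq> dual_ell1"
proof
  assume eq: "adjoint_ell1 T ` dual_ell1 = dual_ell1"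
  obtain x where x: "x \<noteq> 0" "blinfun_apply T x = 0"
    using eigenvector_exists[of 0] by auto
  then obtain n where n: "coord x n \<noteq> 0"
    using ell1_eqI[of x 0] by auto
  define \<psi> where "\<psi> = Blinfun (\<lambda>x. coord x n)"
  have \<psi>: "blinfun_apply \<psi> = (\<lambda>x. coord x n)"
    unfolding \<psi>_def by (rule bounded_linear_Blinfun_apply[OF bounded_linear_coord])
  then have "\<psi> \<in> dual_ell1" by (simp add: dual_ell1_iff)
  then obtain \<phi> where "\<psi> = \<phi> o\<^sub>L T"
    using eq by (auto simp: adjoint_ell1_def)
  then have "blinfun_apply \<psi> x = 0"
    using x by simp
  with n \<psi> show False by simp
qed

text \<open>The kernel is nonzero because 0 is an eigenvalue, and proper because
  \<open>T \<noteq> 0\<close>.\<close>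

lemma kernel_invariant:
  assumes "T \<noteq> 0"
  shows "nontrivial_invariant_subspace T {x. blinfun_apply T x = 0}"
  unfolding nontrivial_invariant_subspace_def
proof (intro conjI)
  show "ell1.subspace {x. blinfun_apply T x = 0}"
    by (auto simp: ell1.subspace_def blinfun.add_right apply_scaleC)
  show "closed {x. blinfun_apply T x = 0}"
    by (intro closed_Collect_eq continuous_intros)
  show "{x. blinfun_apply T x = 0} \<noteq> {0}"
    using eigenvector_exists[of 0] by auto
  show "{x. blinfun_apply T x = 0} \<noteq> UNIV"
    using assms by (auto intro!: blinfun_eqI)
qed auto

end

theorem theorem2p5:
  shows "typical_T1 (\<lambda>T.
            isometry_dual (adjoint_ell1 T) \<and> adjoint_ell1 T ` dual_ell1 \<noteq> dual_ell1 \<and>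
            (\<forall>\<mu> \<in> ball 0 1. surj (\<lambda>x. blinfun_apply T x - \<mu> *\<^sub>C x)) \<and>
            (\<forall>\<mu> \<in> ball 0 1. (\<exists>x. x \<noteq> 0 \<and> blinfun_apply T x = \<mu> *\<^sub>C x) \<and>
               infinite_dim_ell1 {x. blinfun_apply T x - \<mu> *\<^sub>C x = 0}))
       \<and> typical_T1 (\<lambda>T. \<exists>E. nontrivial_invariant_subspace T E)"
\<comment> \<open>Both claims hold on the same comeager set, that of the operators in
  \<open>T1\<close> with recurrent columns.\<close>
proof (intro conjI; rule typical_T1_mono[OF typical_recurrent_columns])
  fix T assume T: "T \<in> T1" "recurrent_columns T"
  then interpret recurrent_contraction T
    by unfold_locales (simp_all add: T1_def)
  show "isometry_dual (adjoint_ell1 T) \<and> adjoint_ell1 T ` dual_ell1 \<noteq> dual_ell1 \<and>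
      (\<forall>\<mu> \<in> ball 0 1. surj (\<lambda>x. blinfun_apply T x - \<mu> *\<^sub>C x)) \<and>
      (\<forall>\<mu> \<in> ball 0 1. (\<exists>x. x \<noteq> 0 \<and> blinfun_apply T x = \<mu> *\<^sub>C x) \<and>
         infinite_dim_ell1 {x. blinfun_apply T x - \<mu> *\<^sub>C x = 0})"
    using isometry_adjoint adjoint_not_surj surj_diff_scaleC eigenvector_exists
      infinite_dim_kernel by simp
  \<comment> \<open>The subdiagonal entries of an operator in \<open>T1\<close> are strictly
    positive.\<close>
  have "T \<noteq> 0"
    using T(1) by (auto simp: T1_def)
  then show "\<exists>E. nontrivial_invariant_subspace T E"
    using kernel_invariant by blast
qed

end
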